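(* Let $N\ge 0$ be an integer, $h>0$, $\omega\in\mathbb{R}$, $\Omega=\omega h$, and assume that the denominator $F_N^-F_{N+1}^++F_N^+F_{N+1}^-$ is nonzero, so that $\Xi_N$ is well defined. Let $\lambda\in\mathbb{C}\setminus\{0\}$. There exists a non-trivial Bloch wave solution $$u_h(x,t)=\mathrm{e}^{-i\omega t}\sum_{m\in\mathbb{Z}}\lambda^m U(x-mh),\qquad \phi_h(x,t)=\mathrm{e}^{-i\omega t}\sum_{m\in\mathbb{Z}}\lambda^m \Phi(x-mh)$$ of the DG scheme with parameter $\alpha=1$ (defined in the context) if and only if $\lambda\in\{\lambda_N^+,\lambda_N^-\}$, where $$\lambda_N^\pm=\frac12\left(\Xi_N\pm\sqrt{\Xi_N^2-4}\right)$$ are the two roots of $\lambda^2-\Xi_N\lambda+1=0$.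
   Context: Mesh and space: $\mathbb{R}$ is partitioned into cells $I_j=((j-\frac12)h,(j+\frac12)h)$, $j\in\mathbb{Z}$, with nodes $x_{j-1/2}=(j-\frac12)h$. Let $V_h^N$ be the space of (complex-valued) functions whose restriction to each $I_j$ is a polynomial of degree at most $N$; global square-integrability is not required for Bloch waves, since the scheme is posed cell by cell. For piecewise polynomial $p$, $p^-_{j-1/2}$ and $p^+_{j-1/2}$ are the limits of $p$ at $x_{j-1/2}$ from the left cell $I_{j-1}$ and the right cell $I_j$; the jump is $[p]_{j-1/2}=p^+_{j-1/2}-p^-_{j-1/2}$ and the mean is $\{p\}_{j-1/2}=\frac12(p^+_{j-1/2}+p^-_{j-1/2})$. DG scheme with parameter $\alpha$: $u_h(\cdot,t),\phi_h(\cdot,t)\in V_h^N$ satisfy, for all $j\in\mathbb{Z}$ and all $v,\psi\in V_h^N$, $$\int_{I_j}(u_h)_t v\,dx-\int_{I_j}u_h v_x\,dx+\widehat u_{j+1/2}v^-_{j+1/2}-\widehat u_{j-1/2}v^+_{j-1/2}=0,$$ $$\int_{I_j}(\phi_h)_t \psi\,dx+\int_{I_j}\phi_h \psi_x\,dx-\widehat \phi_{j+1/2}\psi^-_{j+1/2}+\widehat \phi_{j-1/2}\psi^+_{j-1/2}=0,$$ with numerical fluxes $\widehat u_{j-1/2}=\{u_h\}_{j-1/2}+\frac12\alpha[\phi_h]_{j-1/2}$ and $\widehat\phi_{j-1/2}=\{\phi_h\}_{j-1/2}+\frac12\alpha[u_h]_{j-1/2}$. In a Bloch wave solution, $U,\Phi$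 are polynomials of degree at most $N$ on the cell $I_0$, extended by zero outside $I_0$; non-trivial means $(U,\Phi)\ne(0,0)$. Equivalent eigenvalue problem: after mapping $I_0$ to $[-1,1]$, the existence of such a solution means that there are $(U,\Phi)\ne(0,0)$, polynomials of degree at most $N$ on $[-1,1]$, such that for all polynomials $v,\psi$ of degree at most $N$, with $(f,g)=\int_{-1}^1 fg\,ds$, $$-\tfrac12 i\Omega(U,v)+(U',v)+\tfrac12\big(\lambda U(-1)-U(1)+\alpha(\lambda\Phi(-1)-\Phi(1))\big)v(1)+\tfrac12\big(U(-1)-\lambda^{-1}U(1)-\alpha(\Phi(-1)-\lambda^{-1}\Phi(1))\big)v(-1)=0,$$ $$\tfrac12 i\Omega(\Phi,\psi)+(\Phi',\psi)+\tfrac12\big(\lambda \Phi(-1)-\Phi(1)+\alpha(\lambda U(-1)-U(1))\big)\psi(1)+\tfrac12\big(\Phi(-1)-\lambda^{-1}\Phi(1)-\alpha(U(-1)-\lambda^{-1}U(1))\big)\psi(-1)=0.$$ Constants: ${}_1F_1(a,b,z)=\sum_{m\ge0}\frac{(a)_m}{(b)_m}\frac{z^m}{m!}$ with $(a)_0=1$, $(a)_m=a(a+1)\cdots(a+m-1)$; when $a$ is a non-positive integer the series is understood to terminate at $m=-a$. Set $$F_N^\pm={}_1F_1(-N,-2N-1,\pm i\Omega),\qquad F_{N+1}^\pm={}_1F_1(-N-1,-2N-1,\pm i\Omega),$$ (note that $F_{N+1}^\pm$ also has second parameter $-2N-1$), and $$\Xi_N=\frac{(F_N^-)^2+(F_N^+)^2+(F_{N+1}^-)^2+(F_{N+1}^+)^2}{F_N^-F_{N+1}^++F_N^+F_{N+1}^-}.$$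 *)

theory Defs
  imports "HOL-Analysis.Analysis" "HOL-Computational_Algebra.Polynomial"
begin

definition node :: "real \<Rightarrow> int \<Rightarrow> real" where
  \<comment> \<open>\<open>node h j\<close> is the left endpoint of the cell with index \<open>j\<close>\<close>
  "node h j = (of_int j - 1/2) * h"

definition cell :: "real \<Rightarrow> int \<Rightarrow> real set" where
  "cell h j = {node h j <..< node h (j + 1)}"

text \<open>The values at the nodes are left unconstrained; the scheme never refers to them.\<close>

definition dg_space :: "real \<Rightarrow> nat \<Rightarrow> (real \<Rightarrow> complex) set" where
  "dg_space h N =
     {f. \<forall>j. \<exists>p :: complex poly. degree p \<le> N \<and> (\<forall>x\<in>cell h j. f x = poly p (of_real x))}"

definition trace_left :: "(real \<Rightarrow> complex) \<Rightarrow> real \<Rightarrow> complex" where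
  "trace_left f x = Lim (at_left x) f"

definition trace_right :: "(real \<Rightarrow> complex) \<Rightarrow> real \<Rightarrow> complex" where
  "trace_right f x = Lim (at_right x) f"

definition jump :: "(real \<Rightarrow> complex) \<Rightarrow> real \<Rightarrow> complex" where
  "jump f x = trace_right f x - trace_left f x"

definition mean :: "(real \<Rightarrow> complex) \<Rightarrow> real \<Rightarrow> complex" where
  "mean f x = (trace_right f x + trace_left f x) / 2"

text \<open>
  The flux of the first unknown is \<open>num_flux \<alpha> u \<phi>\<close>, that of the second is
  \<open>num_flux \<alpha> \<phi> u\<close>.
\<close>

definition num_flux :: "real \<Rightarrow> (real \<Rightarrow> complex) \<Rightarrow> (real \<Rightarrow> complex) \<Rightarrow> real \<Rightarrow> complex" where
  "num_flux \<alpha> f g x = mean f x + of_real \<alpha> / 2 * jump g x"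

text \<open>
  Arguments of \<open>u\<close> and \<open>\<phi>\<close> are space first, then time. Differentiability in time is
  required explicitly because \<^const>\<open>vector_derivative\<close> is a total function.
\<close>

definition dg_solution ::
  "real \<Rightarrow> real \<Rightarrow> nat \<Rightarrow> (real \<Rightarrow> real \<Rightarrow> complex) \<Rightarrow> (real \<Rightarrow> real \<Rightarrow> complex) \<Rightarrow> bool" where
  "dg_solution \<alpha> h N u \<phi> \<longleftrightarrow>
     (\<forall>t. (\<lambda>x. u x t) \<in> dg_space h N \<and> (\<lambda>x. \<phi> x t) \<in> dg_space h N) \<and>
     (\<forall>t j. \<forall>x\<in>cell h j. u x differentiable at t \<and> \<phi> x differentiable at t) \<and>
     (\<forall>t j. \<forall>v\<in>dg_space h N. \<forall>\<psi>\<in>dg_space h N.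
        integral (cell h j) (\<lambda>x. vector_derivative (u x) (at t) * v x)
        - integral (cell h j) (\<lambda>x. u x t * vector_derivative v (at x))
        + num_flux \<alpha> (\<lambda>x. u x t) (\<lambda>x. \<phi> x t) (node h (j + 1)) * trace_left v (node h (j + 1))
        - num_flux \<alpha> (\<lambda>x. u x t) (\<lambda>x. \<phi> x t) (node h j) * trace_right v (node h j) = 0 \<and>
        integral (cell h j) (\<lambda>x. vector_derivative (\<phi> x) (at t) * \<psi> x)
        + integral (cell h j) (\<lambda>x. \<phi> x t * vector_derivative \<psi> (at x))
        - num_flux \<alpha> (\<lambda>x. \<phi> x t) (\<lambda>x. u x t) (node h (j + 1)) * trace_left \<psi> (node h (j + 1))
        + num_flux \<alpha> (\<lambda>x. \<phi> x t) (\<lambda>x. u x t) (node h j) * trace_right \<psi> (node h j) = 0)"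

definition cell_polys :: "real \<Rightarrow> nat \<Rightarrow> (real \<Rightarrow> complex) set" where
  "cell_polys h N =
     {f. \<exists>p :: complex poly. degree p \<le> N \<and>
           f = (\<lambda>x. if x \<in> cell h 0 then poly p (of_real x) else 0)}"

text \<open>For each \<open>x\<close> at most one term of the sum is nonzero when \<open>U\<close> vanishes off the cell of index 0.\<close>

definition bloch_wave ::
  "real \<Rightarrow> real \<Rightarrow> complex \<Rightarrow> (real \<Rightarrow> complex) \<Rightarrow> real \<Rightarrow> real \<Rightarrow> complex" where
  "bloch_wave h \<omega> lam U x t =
     exp (- \<i> * of_real (\<omega> * t)) * (\<Sum>\<^sub>\<infinity>m::int. lam powi m * U (x - of_int m * h))"

text \<open>
  If \<open>a = -n\<close> for a natural number \<open>n\<close>, then \<open>pochhammer a m = 0\<close> for \<open>m > n\<close>. Since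
  \<open>0 / 0 = 0\<close>, the series then terminates at \<open>m = n\<close> even if \<open>pochhammer b m\<close> also vanishes
  for large \<open>m\<close>.
\<close>

definition hyp_1F1 :: "complex \<Rightarrow> complex \<Rightarrow> complex \<Rightarrow> complex" where
  "hyp_1F1 a b z = (\<Sum>m. pochhammer a m / pochhammer b m * (z ^ m / fact m))"

text \<open>The same second parameter \<open>-2N-1\<close> is used in both functions.\<close>

definition F_N :: "nat \<Rightarrow> complex \<Rightarrow> complex" where
  "F_N N z = hyp_1F1 (- of_nat N) (- 2 * of_nat N - 1) z"

definition F_N1 :: "nat \<Rightarrow> complex \<Rightarrow> complex" where
  "F_N1 N z = hyp_1F1 (- of_nat N - 1) (- 2 * of_nat N - 1) z"

definition Xi_num :: "nat \<Rightarrow> real \<Rightarrow> complex" where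
  "Xi_num N \<Omega> =
     (F_N N (- \<i> * of_real \<Omega>))\<^sup>2 + (F_N N (\<i> * of_real \<Omega>))\<^sup>2
     + (F_N1 N (- \<i> * of_real \<Omega>))\<^sup>2 + (F_N1 N (\<i> * of_real \<Omega>))\<^sup>2"

definition Xi_den :: "nat \<Rightarrow> real \<Rightarrow> complex" where
  "Xi_den N \<Omega> =
     F_N N (- \<i> * of_real \<Omega>) * F_N1 N (\<i> * of_real \<Omega>)
     + F_N N (\<i> * of_real \<Omega>) * F_N1 N (- \<i> * of_real \<Omega>)"

definition Xi :: "nat \<Rightarrow> real \<Rightarrow> complex" where
  "Xi N \<Omega> = Xi_num N \<Omega> / Xi_den N \<Omega>"

definition lambda_plus :: "nat \<Rightarrow> real \<Rightarrow> complex" where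
  "lambda_plus N \<Omega> = (Xi N \<Omega> + csqrt ((Xi N \<Omega>)\<^sup>2 - 4)) / 2"

definition lambda_minus :: "nat \<Rightarrow> real \<Rightarrow> complex" where
  "lambda_minus N \<Omega> = (Xi N \<Omega> - csqrt ((Xi N \<Omega>)\<^sup>2 - 4)) / 2"

end

theory Submission
  imports Defs
begin

text \<open>
  Put \<open>\<kappa> = \<i>\<Omega>\<close> and map each cell to \<open>[0, 1]\<close>. On a Bloch wave the scheme for \<open>u\<close>
  becomes \<open>\<integral>(P' - \<kappa>P)v = (P(1) - a\<^sub>1)v(1) - (P(0) - a\<^sub>0)v(0)\<close> for all \<open>v\<close> of degree at most
  \<open>N\<close>, where \<open>a\<^sub>1, a\<^sub>0\<close> are the fluxes at the two ends and \<open>a\<^sub>1 = \<lambda>a\<^sub>0\<close>; the equation for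
  \<open>\<phi>\<close> is the same with \<open>-\<kappa>\<close>.

  Let \<open>G = x t\<^sup>N(1-t)\<^bsup>N+1\<^esup> + y t\<^bsup>N+1\<^esup>(1-t)\<^sup>N\<close>. Since \<open>G\<close> vanishes to order \<open>N\<close> at both ends,
  \<open>P = \<Sum>j\<le>N. \<kappa>\<^bsup>N-j\<^esup> G\<^bsup>(N+1+j)\<^esup>\<close> solves this problem, and the fluxes are the values at the
  ends of \<open>\<Sum>j\<le>2N+1. \<kappa>\<^bsup>2N+1-j\<^esup> G\<^bsup>(j)\<^esup>\<close>, which are Pade numerators and denominators of the
  exponential, that is, the functions \<open>F\<^sub>N\<close> and \<open>F\<^bsub>N+1\<^esub>\<close>. For \<open>\<kappa> \<noteq> 0\<close> every solution has this
  form. The definition of the fluxes for \<open>\<alpha> = 1\<close> fixes the parameters of \<open>\<phi>\<close> in terms of those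
  of \<open>u\<close>, and \<open>a\<^sub>1 = \<lambda>a\<^sub>0\<close> for both equations is a 2 by 2 linear system for \<open>(x, y)\<close> with
  determinant proportional to \<open>\<lambda>\<^sup>2 - \<Xi>\<lambda> + 1\<close>. For \<open>\<kappa> = 0\<close> all solutions are constant.
\<close>

subsection \<open>Integrals of polynomials over the unit interval\<close>

definition unit_integral :: "complex poly \<Rightarrow> complex" where
  "unit_integral p = integral {0..1} (\<lambda>t. poly p (of_real t))"

lemma continuous_on_poly_of_real:
  "continuous_on S (\<lambda>t. poly (p :: complex poly) (of_real t))"
  by (intro continuous_intros)

lemma integrable_poly_of_real: "(\<lambda>t. poly (p :: complex poly) (of_real t)) integrable_on {a..b}"
  by (intro integrable_continuous_real continuous_on_poly_of_real)

lemma has_vector_derivative_poly_of_real: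
  "((\<lambda>t. poly (p :: complex poly) (of_real t)) has_vector_derivative poly (pderiv p) (of_real x)) (at x within S)"
  by (rule has_vector_derivative_real_field) (rule poly_DERIV)

lemma unit_integral_0 [simp]: "unit_integral 0 = 0"
  by (simp add: unit_integral_def)

lemma unit_integral_add: "unit_integral (p + q) = unit_integral p + unit_integral q"
  by (simp add: unit_integral_def integral_add integrable_poly_of_real)

lemma unit_integral_diff: "unit_integral (p - q) = unit_integral p - unit_integral q"
  by (simp add: unit_integral_def integral_diff integrable_poly_of_real)

lemma unit_integral_smult: "unit_integral (smult c p) = c * unit_integral p"
  by (simp add: unit_integral_def)

lemma unit_integral_pderiv: "unit_integral (pderiv p) = poly p 1 - poly p 0"
proof -
  have "((\<lambda>t. poly (pderiv p) (of_real t)) has_integral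
          poly p (of_real 1) - poly p (of_real 0)) {0..1}"
    by (rule fundamental_theorem_of_calculus) (auto intro: has_vector_derivative_poly_of_real)
  then show ?thesis
    by (simp add: unit_integral_def integral_unique)
qed

lemma unit_integral_by_parts:
  "unit_integral (pderiv p * q) = poly p 1 * poly q 1 - poly p 0 * poly q 0 - unit_integral (p * pderiv q)"
  using unit_integral_pderiv[of "p * q"]
  by (simp add: pderiv_mult unit_integral_add algebra_simps)

lemma poly_eq_0_of_real_interval:
  fixes p :: "complex poly"
  assumes "a < b" and zero: "\<And>t. a < t \<Longrightarrow> t < b \<Longrightarrow> poly p (of_real t) = 0"
  shows "p = 0"
proof (rule ccontr)
  assume "p \<noteq> 0"
  then have "finite {z. poly p z = 0}"
    by (rule poly_roots_finite)
  moreover have "complex_of_real ` {a<..<b} \<subseteq> {z. poly p z = 0}"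
    using zero by auto
  ultimately have "finite (complex_of_real ` {a<..<b})"
    by (rule rev_finite_subset)
  then have "finite {a<..<b}"
    by (rule finite_imageD) (simp add: inj_on_def)
  with infinite_Ioo[OF \<open>a < b\<close>] show False
    by simp
qed

text \<open>The pairing has no complex conjugation, so the test polynomial is
  \<open>map_poly cnj f\<close>, which is conjugate to \<open>f\<close> at real points. The integral
  of the squared modulus then vanishes, and continuity gives the claim.\<close>

lemma eq_0_if_orthogonal:
  assumes deg: "degree f \<le> N"
    and orth: "\<And>v. degree v \<le> N \<Longrightarrow> unit_integral (f * v) = 0"
  shows "f = 0"
proof (rule poly_eq_0_of_real_interval[of 0 1])
  let ?g = "\<lambda>t::real. (cmod (poly f (of_real t)))\<^sup>2"
  have cont: "continuous_on {0..1} ?g"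
    by (intro continuous_intros)
  have "degree (map_poly cnj f) \<le> N"
    using deg by (simp add: degree_map_poly)
  then have "0 = unit_integral (f * map_poly cnj f)"
    using orth by simp
  also have "\<dots> = integral {0..1} (\<lambda>t. complex_of_real (?g t))"
    unfolding unit_integral_def
  proof (rule integral_cong)
    fix t :: real
    show "poly (f * map_poly cnj f) (of_real t) = complex_of_real (?g t)"
      using poly_cnj[of f "of_real t"] complex_norm_square[of "poly f (of_real t)"] by simp
  qed
  also have "\<dots> = complex_of_real (integral {0..1} ?g)"
    by (intro integral_unique has_integral_of_real integrable_integral integrable_continuous_real cont)
  finally have "integral {0..1} ?g = 0"
    by simp
  then have "\<forall>t\<in>{0..1}. ?g t = 0"
    by (subst (asm) integral_eq_0_iff) (use cont in auto)
  then show "poly f (of_real t) = 0" if "0 < t" "t < 1" for t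
    using that by auto
qed simp

text \<open>Integrating by parts n times moves all derivatives to \<open>v\<close>: the boundary
  terms vanish by assumption, and \<open>v\<close> is differentiated away because its degree is
  below n.\<close>

lemma unit_integral_higher_pderiv_eq_0:
  assumes "\<And>j. j < n \<Longrightarrow> poly ((pderiv ^^ j) G) 0 = 0"
    and "\<And>j. j < n \<Longrightarrow> poly ((pderiv ^^ j) G) 1 = 0"
    and "degree v < n"
  shows "unit_integral ((pderiv ^^ n) G * v) = 0"
  using assms
proof (induction n arbitrary: v)
  case (Suc n)
  have "unit_integral ((pderiv ^^ n) G * pderiv v) = 0"
  \<comment> \<open>The derivative of a constant still has degree 0, which need not be below
    n.\<close>
  proof (cases "degree v = 0")
    case True
    then have "pderiv v = 0" by (simp add: pderiv_eq_0_iff)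
    then show ?thesis by simp
  next
    case False
    with Suc show ?thesis by (simp add: degree_pderiv)
  qed
  then show ?case
    using unit_integral_by_parts[of "(pderiv ^^ n) G" v] Suc.prems by simp
qed simp

subsection \<open>Sums of derivatives and the hypergeometric functions\<close>

lemma poly_higher_pderiv_0: "poly ((pderiv ^^ j) p) (0 :: complex) = fact j * coeff p j"
  by (simp add: poly_0_coeff_0 coeff_higher_pderiv pochhammer_fact)

text \<open>Carries the endpoint 1 to 0, where derivatives can be read off the coefficients.\<close>

definition reflect :: "complex poly \<Rightarrow> complex poly" where
  "reflect p = pcompose p [:1, -1:]"

lemma poly_reflect: "poly (reflect p) x = poly p (1 - x)"
  by (simp add: reflect_def poly_pcompose)

lemma higher_pderiv_reflect: "(pderiv ^^ j) (reflect p) = smult ((-1) ^ j) (reflect ((pderiv ^^ j) p))"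
  by (induction j) (simp_all add: pderiv_smult reflect_def pderiv_pcompose pderiv_pCons)

lemma poly_higher_pderiv_1:
  "poly ((pderiv ^^ j) p) 1 = (-1) ^ j * fact j * coeff (reflect p) j"
  using arg_cong[OF higher_pderiv_reflect[of j p], of "\<lambda>q. poly q 0"]
  by (simp add: poly_higher_pderiv_0 poly_reflect mult.assoc flip: power_mult_distrib)

lemma smult_sum_right: "smult c (sum f A) = (\<Sum>i\<in>A. smult c (f i))"
  by (induction A rule: infinite_finite_induct) (simp_all add: smult_add_right)

text \<open>A truncated Neumann series for the inverse of \<kappa> - d/dt, scaled by
  \<open>\<kappa> ^ Suc n\<close> so that no negative powers occur; such sums appear in Hermite's
  identities for the exponential.\<close>

definition exp_sum :: "nat \<Rightarrow> complex \<Rightarrow> complex poly \<Rightarrow> complex poly" where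
  "exp_sum n \<kappa> G = (\<Sum>j\<le>n. smult (\<kappa> ^ (n - j)) ((pderiv ^^ j) G))"

lemma exp_sum_0 [simp]: "exp_sum 0 \<kappa> G = G"
  by (simp add: exp_sum_def)

lemma exp_sum_Suc: "exp_sum (Suc n) \<kappa> G = smult \<kappa> (exp_sum n \<kappa> G) + (pderiv ^^ Suc n) G"
  by (simp add: exp_sum_def smult_sum_right Suc_diff_le del: funpow.simps)

lemma exp_sum_add: "exp_sum n \<kappa> (G + H) = exp_sum n \<kappa> G + exp_sum n \<kappa> H"
  by (simp add: exp_sum_def higher_pderiv_add smult_add_right sum.distrib)

lemma exp_sum_smult: "exp_sum n \<kappa> (smult c G) = smult c (exp_sum n \<kappa> G)"
  by (simp add: exp_sum_def higher_pderiv_smult smult_sum_right mult.commute)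

text \<open>The sum telescopes: applying d/dt - \<kappa> leaves only the two extreme terms.\<close>

lemma pderiv_exp_sum:
  "pderiv (exp_sum n \<kappa> G) =
     smult \<kappa> (exp_sum n \<kappa> G) - smult (\<kappa> ^ Suc n) G + (pderiv ^^ Suc n) G"
proof (induction n)
  case (Suc n)
  show ?case
    unfolding exp_sum_Suc pderiv_add pderiv_smult Suc
    by (simp add: smult_add_right smult_diff_right exp_sum_Suc)
qed simp

text \<open>The derivatives of order at most m share the factor \<open>\<kappa> ^ Suc n\<close>; the
  higher ones form a sum of the same kind. With n = m = N this compares the flux with the trace of
  the cell solution.\<close>

lemma exp_sum_split:
  "exp_sum (Suc (n + m)) \<kappa> G =
     smult (\<kappa> ^ Suc n) (exp_sum m \<kappa> G) + exp_sum n \<kappa> ((pderiv ^^ Suc m) G)"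
proof (induction n)
  case 0
  show ?case by (simp add: exp_sum_Suc)
next
  case (Suc n)
  have "(pderiv ^^ Suc (Suc n + m)) G = (pderiv ^^ Suc n) ((pderiv ^^ Suc m) G)"
    by (simp only: funpow_add o_apply flip: add_Suc_right)
  with Suc show ?case
    by (simp only: exp_sum_Suc[of "Suc (n + m)"] exp_sum_Suc[of n] add_Suc smult_add_right
        smult_smult power_Suc add.assoc)
qed

lemma poly_exp_sum: "poly (exp_sum n \<kappa> G) x = (\<Sum>j\<le>n. \<kappa> ^ (n - j) * poly ((pderiv ^^ j) G) x)"
  by (simp add: exp_sum_def poly_sum)

text \<open>Reflection multiplies the j-th derivative by (-1)^j. Together with the sign of
  \<open>(- \<kappa>) ^ (n - j)\<close> this is (-1)^n for every j.\<close>

lemma poly_exp_sum_reflect: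
  "poly (exp_sum n \<kappa> G) 1 = (-1) ^ n * poly (exp_sum n (- \<kappa>) (reflect G)) 0"
  unfolding poly_exp_sum sum_distrib_left
proof (rule sum.cong)
  fix j assume "j \<in> {..n}"
  then have "(-1) ^ n = (-1) ^ (n - j) * ((-1) ^ j :: complex)"
    by (simp flip: power_add)
  then show "\<kappa> ^ (n - j) * poly ((pderiv ^^ j) G) 1 =
      (-1) ^ n * ((- \<kappa>) ^ (n - j) * poly ((pderiv ^^ j) (reflect G)) 0)"
    by (simp add: poly_higher_pderiv_1 poly_higher_pderiv_0 power_minus[of \<kappa>] mult_ac)
qed simp

lemma degree_exp_sum_le: "degree (exp_sum n \<kappa> G) \<le> degree G"
  unfolding exp_sum_def
  by (intro degree_sum_le) (auto intro: order.trans[OF degree_smult_le] simp: degree_higher_pderiv)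

section \<open>Unnormalised Bernstein polynomials and terminating confluent hypergeometric
  series\<close>

definition bernstein :: "nat \<Rightarrow> nat \<Rightarrow> complex poly" where
  "bernstein m k = [:0, 1:] ^ m * [:1, -1:] ^ k"

lemma reflect_power: "reflect (p ^ n) = reflect p ^ n"
  by (induction n) (simp_all add: reflect_def pcompose_1 pcompose_mult)

lemma reflect_bernstein: "reflect (bernstein m k) = bernstein k m"
proof -
  have "reflect (p * q) = reflect p * reflect q" for p q
    by (simp add: reflect_def pcompose_mult)
  moreover have "reflect [:0, 1:] = [:1, -1:]" "reflect [:1, -1:] = [:0, 1:]"
    by (simp_all add: reflect_def pcompose_pCons)
  ultimately show ?thesis
    by (simp add: bernstein_def reflect_power mult.commute)
qed

lemma degree_bernstein: "degree (bernstein m k) = m + k"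
  by (simp add: bernstein_def degree_mult_eq degree_power_eq)

lemma coeff_bernstein:
  "coeff (bernstein m k) j = (if j < m then 0 else (-1) ^ (j - m) * of_nat (k choose (j - m)))"
proof -
  have "coeff ([:1, -1 :: complex:] ^ k) i = (-1) ^ i * of_nat (k choose i)" for i
  proof (cases "i \<le> k")
    case True
    then show ?thesis by (simp add: coeff_linear_poly_power mult.commute)
  next
    case False
    then have "degree ([:1, -1 :: complex:] ^ k) < i"
      by (simp add: degree_power_eq)
    then have "coeff ([:1, -1 :: complex:] ^ k) i = 0"
      by (rule coeff_eq_0)
    with False show ?thesis
      by (simp add: binomial_eq_0)
  qed
  moreover have "[:0, 1:] ^ m = monom (1 :: complex) m"
    by (simp add: monom_altdef)
  ultimately show ?thesis
    by (simp add: bernstein_def coeff_monom_mult)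
qed

lemma pochhammer_minus_of_nat:
  "l \<le> n \<Longrightarrow> fact (n - l) * pochhammer (- of_nat n) l = (-1) ^ l * (fact n :: complex)"
proof (induction l)
  case (Suc l)
  then have "fact (n - l) = of_nat (n - l) * (fact (n - Suc l) :: complex)"
    by (metis Suc_diff_Suc Suc_le_lessD fact_Suc of_nat_Suc)
  moreover have "of_nat (n - l) = of_nat n - (of_nat l :: complex)"
    using Suc.prems by (simp add: of_nat_diff)
  ultimately have *: "fact (n - l) = (of_nat n - of_nat l) * (fact (n - Suc l) :: complex)"
    by simp
  have "fact (n - Suc l) * (pochhammer (- of_nat n) l * (- of_nat n + of_nat l)) =
      - (fact (n - l) * pochhammer (- of_nat n) l :: complex)"
    unfolding * by (simp add: algebra_simps)
  then show ?case
    using Suc by (simp add: pochhammer_Suc)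
qed simp

text \<open>For l at most k both Pochhammer symbols are signed quotients of factorials; the signs
  cancel, and the prefactor clears the denominator.\<close>

lemma hyp_1F1_minus_of_nat:
  "fact (m + k) * hyp_1F1 (- of_nat k) (- of_nat (m + k)) z =
     (\<Sum>l\<le>k. of_nat (k choose l) * fact (m + k - l) * z ^ l)"
proof -
  let ?f = "\<lambda>l. pochhammer (- of_nat k) l / pochhammer (- of_nat (m + k)) l * (z ^ l / fact l)"
  \<comment> \<open>The terms beyond k vanish through their numerators, also where the denominator
    is 0, since division by 0 gives 0.\<close>
  have "hyp_1F1 (- of_nat k) (- of_nat (m + k)) z = (\<Sum>l\<le>k. ?f l)"
    unfolding hyp_1F1_def
    by (rule suminf_finite) (auto simp: pochhammer_of_nat_eq_0_lemma)
  moreover have "fact (m + k) * ?f l = of_nat (k choose l) * fact (m + k - l) * z ^ l" if "l \<le> k" for l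
  proof -
    have 1: "pochhammer (- of_nat (m + k)) l = (-1) ^ l * fact (m + k) / (fact (m + k - l) :: complex)"
      using pochhammer_minus_of_nat[of l "m + k"] that by (simp add: field_simps)
    have 2: "pochhammer (- of_nat k) l = (-1) ^ l * fact k / (fact (k - l) :: complex)"
      using pochhammer_minus_of_nat[of l k] that by (simp add: field_simps)
    show ?thesis
      unfolding 1 2 binomial_fact[OF that] by (simp add: field_simps)
  qed
  ultimately show ?thesis
    by (simp add: sum_distrib_left)
qed

text \<open>Derivatives at 0 are factorials times coefficients, and only the orders from m to m + k
  contribute. Reversing the order of summation by l = m + k - j produces the terminating
  series.\<close>

lemma poly_exp_sum_bernstein_0:
  "poly (exp_sum (m + k) \<kappa> (bernstein m k)) 0 =
     (-1) ^ k * fact (m + k) * hyp_1F1 (- of_nat k) (- of_nat (m + k)) (- \<kappa>)"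
proof -
  have "poly (exp_sum (m + k) \<kappa> (bernstein m k)) 0 =
      (\<Sum>j\<in>{m..m + k}. \<kappa> ^ (m + k - j) * (fact j * coeff (bernstein m k) j))"
    unfolding poly_exp_sum poly_higher_pderiv_0
    by (rule sum.mono_neutral_right) (auto simp: coeff_bernstein)
  also have "\<dots> = (\<Sum>l\<le>k. (-1) ^ k * (of_nat (k choose l) * fact (m + k - l) * (- \<kappa>) ^ l))"
  proof (rule sum.reindex_bij_witness[of _ "\<lambda>l. m + k - l" "\<lambda>j. m + k - j"])
    fix j assume j: "j \<in> {m..m + k}"
    define l where "l = m + k - j"
    have l: "j = m + k - l" "l \<le> k" "j - m = k - l"
      using j by (auto simp: l_def)
    have "(-1) ^ (k - l) = (-1) ^ k * ((-1) ^ l :: complex)"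
      using \<open>l \<le> k\<close> by (simp add: uminus_power_if)
    then show "(-1) ^ k * (of_nat (k choose (m + k - j)) * fact (m + k - (m + k - j)) * (- \<kappa>) ^ (m + k - j)) =
        \<kappa> ^ (m + k - j) * (fact j * coeff (bernstein m k) j)"
      using j l binomial_symmetric[OF \<open>l \<le> k\<close>] unfolding l_def[symmetric]
      by (simp add: coeff_bernstein power_minus[of \<kappa>])
  qed auto
  also have "\<dots> = (-1) ^ k * (fact (m + k) * hyp_1F1 (- of_nat k) (- of_nat (m + k)) (- \<kappa>))"
    by (simp only: hyp_1F1_minus_of_nat sum_distrib_left)
  finally show ?thesis
    by simp
qed

text \<open>The general polynomial of degree at most 2N+1 that vanishes to order N at both ends. The
  parameters are, up to constants, the N-th derivatives at 0 and at 1.\<close>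

definition bubble :: "nat \<Rightarrow> complex \<Rightarrow> complex \<Rightarrow> complex poly" where
  "bubble N x y = smult x (bernstein N (Suc N)) + smult y (bernstein (Suc N) N)"

lemma reflect_bubble: "reflect (bubble N x y) = bubble N y x"
  by (simp add: bubble_def reflect_def pcompose_add pcompose_smult
      reflect_bernstein[unfolded reflect_def])

lemma degree_bubble_le: "degree (bubble N x y) \<le> Suc (N + N)"
  unfolding bubble_def
  by (intro degree_add_le order.trans[OF degree_smult_le]) (simp_all add: degree_bernstein)

lemma poly_higher_pderiv_bubble:
  "j < N \<Longrightarrow> poly ((pderiv ^^ j) (bubble N x y)) 0 = 0"
  "j < N \<Longrightarrow> poly ((pderiv ^^ j) (bubble N x y)) 1 = 0"
  "poly ((pderiv ^^ N) (bubble N x y)) 0 = fact N * x"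
  "poly ((pderiv ^^ N) (bubble N x y)) 1 = (-1) ^ N * fact N * y"
  by (simp_all add: poly_higher_pderiv_0 poly_higher_pderiv_1 reflect_bubble)
     (simp_all add: bubble_def coeff_bernstein)

text \<open>Both Bernstein polynomials have degree 2N+1, hence the common second parameter of
  \<open>F_N\<close> and \<open>F_N1\<close>. The exponents of 1-t, N+1 and N, give the first
  parameters and the opposite signs.\<close>

lemma poly_exp_sum_bubble_0:
  "poly (exp_sum (Suc (N + N)) \<kappa> (bubble N x y)) 0 =
     (-1) ^ N * fact (Suc (N + N)) * (y * F_N N (- \<kappa>) - x * F_N1 N (- \<kappa>))"
proof -
  have "poly (exp_sum (Suc (N + N)) \<kappa> (bernstein N (Suc N))) 0 =
      - ((-1) ^ N * fact (Suc (N + N)) * F_N1 N (- \<kappa>))"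
  proof -
    have arg: "- of_nat (Suc N) = - of_nat N - (1 :: complex)"
      "- of_nat (N + Suc N) = - 2 * of_nat N - (1 :: complex)"
      by simp_all
    show ?thesis
      using poly_exp_sum_bernstein_0[of N "Suc N" \<kappa>, unfolded arg]
      by (simp add: F_N1_def del: fact_Suc)
  qed
  moreover have "poly (exp_sum (Suc (N + N)) \<kappa> (bernstein (Suc N) N)) 0 =
      (-1) ^ N * fact (Suc (N + N)) * F_N N (- \<kappa>)"
  proof -
    have arg: "- of_nat (Suc N + N) = - 2 * of_nat N - (1 :: complex)"
      by simp
    show ?thesis
      using poly_exp_sum_bernstein_0[of "Suc N" N \<kappa>, unfolded arg]
      by (simp add: F_N_def del: fact_Suc)
  qed
  ultimately show ?thesis
    by (simp add: bubble_def exp_sum_add exp_sum_smult algebra_simps del: fact_Suc)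
qed

lemma poly_exp_sum_bubble_1:
  "poly (exp_sum (Suc (N + N)) \<kappa> (bubble N x y)) 1 =
     (-1) ^ N * fact (Suc (N + N)) * (y * F_N1 N \<kappa> - x * F_N N \<kappa>)"
  unfolding poly_exp_sum_reflect reflect_bubble poly_exp_sum_bubble_0
  by (simp add: algebra_simps)

subsection \<open>The weak form on one cell\<close>

text \<open>The end values are kept independent of \<open>P\<close>, so that the cell problem can be
  solved before the fluxes are coupled to the traces.\<close>

definition weak_form :: "nat \<Rightarrow> complex \<Rightarrow> complex poly \<Rightarrow> complex \<Rightarrow> complex \<Rightarrow> bool" where
  "weak_form N \<kappa> P a0 a1 \<longleftrightarrow>
     (\<forall>v. degree v \<le> N \<longrightarrow>
        unit_integral (P * pderiv v) + \<kappa> * unit_integral (P * v) = a1 * poly v 1 - a0 * poly v 0)"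

text \<open>Integration by parts gives the strong form, in which only the defects, trace minus flux
  at each end, appear on the right.\<close>

lemma weak_form_iff:
  "weak_form N \<kappa> P a0 a1 \<longleftrightarrow>
     (\<forall>v. degree v \<le> N \<longrightarrow>
        unit_integral ((pderiv P - smult \<kappa> P) * v) =
          (poly P 1 - a1) * poly v 1 - (poly P 0 - a0) * poly v 0)"
  unfolding weak_form_def
  by (simp add: left_diff_distrib unit_integral_diff unit_integral_by_parts unit_integral_smult)
     (auto simp: algebra_simps)

lemma weak_form_diff:
  assumes "weak_form N \<kappa> P a0 a1" "weak_form N \<kappa> Q b0 b1"
  shows "weak_form N \<kappa> (P - Q) (a0 - b0) (a1 - b1)"
  unfolding weak_form_def
proof (intro allI impI)
  fix v :: "complex poly"
  assume v: "degree v \<le> N"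
  have "unit_integral (P * pderiv v) + \<kappa> * unit_integral (P * v) = a1 * poly v 1 - a0 * poly v 0"
    "unit_integral (Q * pderiv v) + \<kappa> * unit_integral (Q * v) = b1 * poly v 1 - b0 * poly v 0"
    using assms v by (simp_all add: weak_form_def)
  then show "unit_integral ((P - Q) * pderiv v) + \<kappa> * unit_integral ((P - Q) * v) =
      (a1 - b1) * poly v 1 - (a0 - b0) * poly v 0"
    by (simp add: left_diff_distrib right_diff_distrib unit_integral_diff) algebra
qed

text \<open>The derivatives of order above N in the full sum for the bubble; this cut brings the
  degree down to N.\<close>

definition cell_solution :: "nat \<Rightarrow> complex \<Rightarrow> complex \<Rightarrow> complex \<Rightarrow> complex poly" where
  "cell_solution N \<kappa> x y = exp_sum N \<kappa> ((pderiv ^^ Suc N) (bubble N x y))"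

lemma degree_cell_solution_le: "degree (cell_solution N \<kappa> x y) \<le> N"
  using degree_exp_sum_le[of N \<kappa> "(pderiv ^^ Suc N) (bubble N x y)"] degree_bubble_le[of N x y]
  by (simp add: cell_solution_def degree_higher_pderiv del: funpow.simps)

text \<open>Split the full sum after order N. At the ends the lower half reduces to its last term,
  because the derivatives of the bubble below order N vanish there.\<close>

lemma exp_sum_bubble_eq:
  "poly (exp_sum (Suc (N + N)) \<kappa> (bubble N x y)) 0 =
     poly (cell_solution N \<kappa> x y) 0 + \<kappa> ^ Suc N * fact N * x"
  "poly (exp_sum (Suc (N + N)) \<kappa> (bubble N x y)) 1 =
     poly (cell_solution N \<kappa> x y) 1 + \<kappa> ^ Suc N * (-1) ^ N * fact N * y"
proof -
  have "poly (exp_sum N \<kappa> (bubble N x y)) e = poly ((pderiv ^^ N) (bubble N x y)) e"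
    if "\<And>j. j < N \<Longrightarrow> poly ((pderiv ^^ j) (bubble N x y)) e = 0" for e
  proof -
    have "poly (exp_sum N \<kappa> (bubble N x y)) e =
        (\<Sum>j\<in>{N}. \<kappa> ^ (N - j) * poly ((pderiv ^^ j) (bubble N x y)) e)"
      unfolding poly_exp_sum by (rule sum.mono_neutral_right) (auto simp: that)
    then show ?thesis by simp
  qed
  from this[of 0] this[of 1] show
    "poly (exp_sum (Suc (N + N)) \<kappa> (bubble N x y)) 0 =
       poly (cell_solution N \<kappa> x y) 0 + \<kappa> ^ Suc N * fact N * x"
    "poly (exp_sum (Suc (N + N)) \<kappa> (bubble N x y)) 1 =
       poly (cell_solution N \<kappa> x y) 1 + \<kappa> ^ Suc N * (-1) ^ N * fact N * y"
    unfolding exp_sum_split by (simp_all add: poly_higher_pderiv_bubble cell_solution_def)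
qed

text \<open>The residual P' - \<kappa>P is a multiple of the derivative of order N+1 of the bubble.
  One integration by parts against \<open>v\<close> leaves boundary terms, which are exactly the
  defects, and an integral that vanishes by orthogonality to degree below N.\<close>

lemma weak_form_cell_solution:
  "weak_form N \<kappa> (cell_solution N \<kappa> x y)
     (poly (exp_sum (Suc (N + N)) \<kappa> (bubble N x y)) 0)
     (poly (exp_sum (Suc (N + N)) \<kappa> (bubble N x y)) 1)"
  unfolding weak_form_iff
proof (intro allI impI)
  fix v :: "complex poly"
  assume v: "degree v \<le> N"
  let ?G = "bubble N x y"
  have top: "(pderiv ^^ Suc N) ((pderiv ^^ Suc N) ?G) = 0"
  proof -
    have "(pderiv ^^ Suc N) ((pderiv ^^ Suc N) ?G) = (pderiv ^^ (Suc N + Suc N)) ?G"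
      by (simp only: funpow_add o_apply)
    also have "\<dots> = 0"
      using degree_bubble_le[of N x y]
      by (intro poly_eqI) (simp add: coeff_higher_pderiv coeff_eq_0 del: funpow.simps)
    finally show ?thesis .
  qed
  have ode: "pderiv (cell_solution N \<kappa> x y) - smult \<kappa> (cell_solution N \<kappa> x y) =
      - smult (\<kappa> ^ Suc N) (pderiv ((pderiv ^^ N) ?G))"
    unfolding cell_solution_def pderiv_exp_sum top by simp
  have "unit_integral ((pderiv ^^ N) ?G * pderiv v) = 0"
  proof (cases "degree v = 0")
    case True
    then have "pderiv v = 0" by (simp add: pderiv_eq_0_iff)
    then show ?thesis by simp
  next
    case False
    with v show ?thesis
      by (intro unit_integral_higher_pderiv_eq_0) (auto simp: poly_higher_pderiv_bubble degree_pderiv)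
  qed
  then have "unit_integral (pderiv ((pderiv ^^ N) ?G) * v) =
      (-1) ^ N * fact N * y * poly v 1 - fact N * x * poly v 0"
    by (simp add: unit_integral_by_parts poly_higher_pderiv_bubble)
  moreover have "unit_integral (- smult c p * v) = - c * unit_integral (p * v)" for c p
    using unit_integral_smult[of "- c" "p * v"] by simp
  ultimately have int: "unit_integral (- smult (\<kappa> ^ Suc N) (pderiv ((pderiv ^^ N) ?G)) * v) =
      - (\<kappa> ^ Suc N) * ((-1) ^ N * fact N * y * poly v 1 - fact N * x * poly v 0)"
    by metis
  show "unit_integral
      ((pderiv (cell_solution N \<kappa> x y) - smult \<kappa> (cell_solution N \<kappa> x y)) * v) =
      (poly (cell_solution N \<kappa> x y) 1 - poly (exp_sum (Suc (N + N)) \<kappa> ?G) 1) * poly v 1 -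
      (poly (cell_solution N \<kappa> x y) 0 - poly (exp_sum (Suc (N + N)) \<kappa> ?G) 0) * poly v 0"
    unfolding ode int exp_sum_bubble_eq by (simp add: algebra_simps)
qed

text \<open>Without defects the residual P' - \<kappa>P is orthogonal to all polynomials of degree
  at most N, and it is one of them.\<close>

lemma weak_form_homogeneous:
  assumes P: "degree P \<le> N" and weak: "weak_form N \<kappa> P (poly P 0) (poly P 1)"
  shows "pderiv P = smult \<kappa> P"
proof -
  have "degree (pderiv P - smult \<kappa> P) \<le> N"
    using P by (intro degree_diff_le order.trans[OF degree_smult_le]) (auto simp: degree_pderiv)
  then have "pderiv P - smult \<kappa> P = 0"
    by (rule eq_0_if_orthogonal) (use weak in \<open>simp add: weak_form_iff\<close>)
  then show ?thesis by simp
qed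

lemma pderiv_eq_smult_imp_0:
  assumes "pderiv P = smult \<kappa> P" "\<kappa> \<noteq> 0"
  shows "P = (0 :: complex poly)"
proof -
  have "degree P - 1 = degree P"
    using arg_cong[OF assms(1), of degree] assms(2) by (simp add: degree_pderiv)
  then have "degree P = 0" by simp
  then have "pderiv P = 0" by (simp add: pderiv_eq_0_iff)
  with assms show ?thesis by simp
qed

text \<open>Both defects can be matched by a cell solution, since \<kappa> may be divided out. The
  difference has no defects, so it solves P' = \<kappa>P and is zero by comparison of
  degrees.\<close>

lemma weak_form_imp_cell_solution:
  assumes \<kappa>: "\<kappa> \<noteq> 0" and P: "degree P \<le> N" and weak: "weak_form N \<kappa> P a0 a1"
  obtains x y where "P = cell_solution N \<kappa> x y"
    "a0 = poly (exp_sum (Suc (N + N)) \<kappa> (bubble N x y)) 0"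
    "a1 = poly (exp_sum (Suc (N + N)) \<kappa> (bubble N x y)) 1"
proof -
  \<comment> \<open>These values invert \<open>exp_sum_bubble_eq\<close>.\<close>
  define x where "x = (a0 - poly P 0) / (\<kappa> ^ Suc N * fact N)"
  define y where "y = (a1 - poly P 1) / (\<kappa> ^ Suc N * (-1) ^ N * fact N)"
  let ?u = "cell_solution N \<kappa> x y" and ?e = "poly (exp_sum (Suc (N + N)) \<kappa> (bubble N x y))"
  have e: "?e 0 = poly ?u 0 + (a0 - poly P 0)" "?e 1 = poly ?u 1 + (a1 - poly P 1)"
    using \<kappa> unfolding exp_sum_bubble_eq by (simp_all add: x_def y_def)
  have "weak_form N \<kappa> (P - ?u) (a0 - ?e 0) (a1 - ?e 1)"
    by (intro weak_form_diff weak weak_form_cell_solution)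
  then have "weak_form N \<kappa> (P - ?u) (poly (P - ?u) 0) (poly (P - ?u) 1)"
    by (simp add: e)
  then have "pderiv (P - ?u) = smult \<kappa> (P - ?u)"
    by (intro weak_form_homogeneous) (use P degree_cell_solution_le in \<open>auto intro: degree_diff_le\<close>)
  with \<kappa> have "P = ?u"
    using pderiv_eq_smult_imp_0 by fastforce
  with e show thesis
    by (intro that[of x y]) simp_all
qed

text \<open>For \<open>\<kappa> = 0\<close>, test with the Legendre polynomial, which is orthogonal to \<open>P'\<close>.\<close>

lemma weak_form_0_defects:
  assumes weak: "weak_form N 0 P a0 a1" and P: "degree P \<le> N"
  shows "(-1) ^ N * (a1 - poly P 1) = a0 - poly P 0"
proof -
  \<comment> \<open>Rodrigues' formula for the shifted Legendre polynomial, up to a constant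
    factor.\<close>
  let ?L = "(pderiv ^^ N) (bernstein N N)"
  have bernstein_deriv: "poly ((pderiv ^^ j) (bernstein N N)) 0 = 0"
    "poly ((pderiv ^^ j) (bernstein N N)) 1 = 0" if "j < N" for j
    using that by (simp_all add: poly_higher_pderiv_0 poly_higher_pderiv_1 reflect_bernstein coeff_bernstein)
  have "unit_integral (pderiv P * ?L) = 0"
  proof (cases "degree P = 0")
    case True
    then have "pderiv P = 0" by (simp add: pderiv_eq_0_iff)
    then show ?thesis by simp
  next
    case False
    then have "degree (pderiv P) < N"
      using P by (simp add: degree_pderiv)
    then have "unit_integral (?L * pderiv P) = 0"
      by (intro unit_integral_higher_pderiv_eq_0) (auto simp: bernstein_deriv)
    then show ?thesis by (simp only: mult.commute)
  qed
  moreover have "degree ?L \<le> N"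
    by (simp add: degree_higher_pderiv degree_bernstein)
  moreover have "poly ?L 0 = fact N" "poly ?L 1 = (-1) ^ N * fact N"
    by (simp_all add: poly_higher_pderiv_0 poly_higher_pderiv_1 reflect_bernstein coeff_bernstein)
  ultimately have "(poly P 1 - a1) * ((-1) ^ N * fact N) = (poly P 0 - a0) * fact N"
    using weak unfolding weak_form_iff by simp
  then have "fact N * ((-1) ^ N * (a1 - poly P 1)) = fact N * (a0 - poly P 0)"
    by (simp add: algebra_simps)
  then show ?thesis by simp
qed

subsection \<open>The eigenvalue problem\<close>

text \<open>
  \<open>a\<close> and \<open>b\<close> are the fluxes of the two unknowns at the right end of the cell; the last two
  equations are their definition for \<open>\<alpha> = 1\<close>.
\<close>

definition bloch_eigenvalue :: "nat \<Rightarrow> complex \<Rightarrow> complex \<Rightarrow> bool" where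
  "bloch_eigenvalue N \<kappa> lam \<longleftrightarrow>
     (\<exists>P Q a b. degree P \<le> N \<and> degree Q \<le> N \<and> (P, Q) \<noteq> (0, 0) \<and>
        weak_form N \<kappa> P (a / lam) a \<and> weak_form N (- \<kappa>) Q (b / lam) b \<and>
        a + b = lam * (poly P 0 + poly Q 0) \<and> a - b = poly P 1 - poly Q 1)"

lemma singular_2x2:
  fixes a b c d :: "'a::field"
  shows "(\<exists>x y. (x, y) \<noteq> (0, 0) \<and> a * x + b * y = 0 \<and> c * x + d * y = 0) \<longleftrightarrow> a * d = b * c"
proof
  assume "\<exists>x y. (x, y) \<noteq> (0, 0) \<and> a * x + b * y = 0 \<and> c * x + d * y = 0"
  then obtain x y where nz: "x \<noteq> 0 \<or> y \<noteq> 0" and xy: "a * x + b * y = 0" "c * x + d * y = 0"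
    by auto
  \<comment> \<open>Cramer's rule: the determinant annihilates every solution.\<close>
  have "(a * d - b * c) * x = d * (a * x + b * y) - b * (c * x + d * y)"
    "(a * d - b * c) * y = a * (c * x + d * y) - c * (a * x + b * y)"
    by (simp_all add: algebra_simps)
  then have "(a * d - b * c) * x = 0" "(a * d - b * c) * y = 0"
    by (simp_all add: xy)
  with nz show "a * d = b * c"
    by auto
next
  assume *: "a * d = b * c"
  \<comment> \<open>A nonzero row is annihilated by its own rotation by a right angle; the vanishing
    determinant extends this to the other row.\<close>
  consider "(a, b) \<noteq> (0, 0)" | "(c, d) \<noteq> (0, 0)" | "a = 0" "b = 0" "c = 0" "d = 0"
    by auto
  then show "\<exists>x y. (x, y) \<noteq> (0, 0) \<and> a * x + b * y = 0 \<and> c * x + d * y = 0"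
  proof cases
    case 1
    with * show ?thesis by (intro exI[of _ "- b"] exI[of _ a]) (auto simp: mult_ac)
  next
    case 2
    with * show ?thesis by (intro exI[of _ "- d"] exI[of _ c]) (auto simp: mult_ac)
  next
    case 3
    then show ?thesis by (intro exI[of _ 1]) simp
  qed
qed

text \<open>Both unknowns are cell solutions. The flux definitions express the parameters of the
  second through those of the first, and the Bloch condition on the two fluxes becomes a homogeneous
  2 by 2 system for \<open>x\<close> and \<open>y\<close>.\<close>

lemma bloch_eigenvalue_nonzero:
  assumes \<kappa>: "\<kappa> \<noteq> 0" and lam: "lam \<noteq> 0"
  shows "bloch_eigenvalue N \<kappa> lam \<longleftrightarrow>
    (1 + lam\<^sup>2) * (F_N N (- \<kappa>) * F_N1 N \<kappa> + F_N N \<kappa> * F_N1 N (- \<kappa>)) =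
    lam * ((F_N N (- \<kappa>))\<^sup>2 + (F_N N \<kappa>)\<^sup>2 + (F_N1 N (- \<kappa>))\<^sup>2 + (F_N1 N \<kappa>)\<^sup>2)"
    (is "_ \<longleftrightarrow> ?det")
proof -
  let ?e = "\<lambda>\<kappa> x y. poly (exp_sum (Suc (N + N)) \<kappa> (bubble N x y))"
  define q p q' p' where "q = F_N N \<kappa>" "p = F_N1 N \<kappa>" "q' = F_N N (- \<kappa>)" "p' = F_N1 N (- \<kappa>)"
  let ?sys = "\<lambda>x y. (lam * p' - q) * x + (p - lam * q') * y = 0 \<and>
    (q' - lam * p) * x + (p' - lam * q) * y = 0"
  \<comment> \<open>The sign acquired by \<open>\<kappa> ^ Suc N\<close> when \<kappa> changes
    sign.\<close>
  define s :: complex where "s = (-1) ^ Suc N"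
  have s: "s * s = 1" "s \<noteq> 0"
    by (cases "even N"; simp add: s_def)+
  have flux: "?e \<kappa> x y 0 = ?e \<kappa> x y 1 / lam \<longleftrightarrow> (lam * p' - q) * x + (p - lam * q') * y = 0"
    "?e (- \<kappa>) (- s * x) (s * y) 0 = ?e (- \<kappa>) (- s * x) (s * y) 1 / lam \<longleftrightarrow>
       (q' - lam * p) * x + (p' - lam * q) * y = 0" for x y
  proof -
    have "?e \<kappa> x y 0 = ?e \<kappa> x y 1 / lam \<longleftrightarrow> lam * ?e \<kappa> x y 0 - ?e \<kappa> x y 1 = 0"
      using lam by (auto simp: field_simps)
    also have "lam * ?e \<kappa> x y 0 - ?e \<kappa> x y 1 =
        - ((-1) ^ N * fact (Suc (N + N))) * ((lam * p' - q) * x + (p - lam * q') * y)"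
      unfolding poly_exp_sum_bubble_0 poly_exp_sum_bubble_1 q_p_q'_p'_def
      by (simp add: algebra_simps del: fact_Suc)
    finally show "?e \<kappa> x y 0 = ?e \<kappa> x y 1 / lam \<longleftrightarrow> (lam * p' - q) * x + (p - lam * q') * y = 0"
      by (simp del: fact_Suc)
    have "?e (- \<kappa>) (- s * x) (s * y) 0 = ?e (- \<kappa>) (- s * x) (s * y) 1 / lam \<longleftrightarrow>
        lam * ?e (- \<kappa>) (- s * x) (s * y) 0 - ?e (- \<kappa>) (- s * x) (s * y) 1 = 0"
      using lam by (auto simp: field_simps)
    also have "lam * ?e (- \<kappa>) (- s * x) (s * y) 0 - ?e (- \<kappa>) (- s * x) (s * y) 1 =
        - (s * (-1) ^ N * fact (Suc (N + N))) * ((q' - lam * p) * x + (p' - lam * q) * y)"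
      unfolding poly_exp_sum_bubble_0 poly_exp_sum_bubble_1 q_p_q'_p'_def minus_minus
      by (simp add: algebra_simps del: fact_Suc)
    finally show "?e (- \<kappa>) (- s * x) (s * y) 0 = ?e (- \<kappa>) (- s * x) (s * y) 1 / lam \<longleftrightarrow>
       (q' - lam * p) * x + (p' - lam * q) * y = 0"
      using s by (simp del: fact_Suc)
  qed
  \<comment> \<open>By \<open>exp_sum_bubble_eq\<close> these conditions concern the defects only:
    those of the two unknowns cancel at the left end and agree at the right end.\<close>
  have coupling: "?e \<kappa> x y 0 + ?e (- \<kappa>) x' y' 0 =
      poly (cell_solution N \<kappa> x y) 0 + poly (cell_solution N (- \<kappa>) x' y') 0 \<longleftrightarrow> x' = - s * x"
    "?e \<kappa> x y 1 - ?e (- \<kappa>) x' y' 1 =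
      poly (cell_solution N \<kappa> x y) 1 - poly (cell_solution N (- \<kappa>) x' y') 1 \<longleftrightarrow> y' = s * y" for x y x' y'
  proof -
    have pow: "(- \<kappa>) ^ Suc N = s * \<kappa> ^ Suc N"
      by (simp only: s_def power_minus[of \<kappa>])
    have "?e \<kappa> x y 0 + ?e (- \<kappa>) x' y' 0 =
        poly (cell_solution N \<kappa> x y) 0 + poly (cell_solution N (- \<kappa>) x' y') 0 \<longleftrightarrow>
        \<kappa> ^ Suc N * fact N * (x + s * x') = 0"
      unfolding exp_sum_bubble_eq pow by (auto simp: algebra_simps add_eq_0_iff)
    also have "\<dots> \<longleftrightarrow> s * (x + s * x') = 0"
      using \<kappa> s by simp
    also have "s * (x + s * x') = x' - (- s * x)"
      using s(1) by algebra
    finally show "?e \<kappa> x y 0 + ?e (- \<kappa>) x' y' 0 =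
        poly (cell_solution N \<kappa> x y) 0 + poly (cell_solution N (- \<kappa>) x' y') 0 \<longleftrightarrow> x' = - s * x"
      by (simp only: right_minus_eq)
    have "?e \<kappa> x y 1 - ?e (- \<kappa>) x' y' 1 =
        poly (cell_solution N \<kappa> x y) 1 - poly (cell_solution N (- \<kappa>) x' y') 1 \<longleftrightarrow>
        \<kappa> ^ Suc N * (-1) ^ N * fact N * (y - s * y') = 0"
      unfolding exp_sum_bubble_eq pow by (simp add: algebra_simps)
    also have "\<dots> \<longleftrightarrow> s * (s * y' - y) = 0"
      using \<kappa> s by auto
    also have "s * (s * y' - y) = y' - s * y"
      using s(1) by algebra
    finally show "?e \<kappa> x y 1 - ?e (- \<kappa>) x' y' 1 =
        poly (cell_solution N \<kappa> x y) 1 - poly (cell_solution N (- \<kappa>) x' y') 1 \<longleftrightarrow> y' = s * y"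
      by (simp only: right_minus_eq)
  qed
  have "bloch_eigenvalue N \<kappa> lam \<longleftrightarrow> (\<exists>x y. (x, y) \<noteq> (0, 0) \<and> ?sys x y)"
  proof
    assume "bloch_eigenvalue N \<kappa> lam"
    then obtain P Q a b where deg: "degree P \<le> N" "degree Q \<le> N" and nz: "(P, Q) \<noteq> (0, 0)"
      and P: "weak_form N \<kappa> P (a / lam) a" and Q: "weak_form N (- \<kappa>) Q (b / lam) b"
      and ab: "a + b = lam * (poly P 0 + poly Q 0)" "a - b = poly P 1 - poly Q 1"
      unfolding bloch_eigenvalue_def by blast
    obtain x y where xy: "P = cell_solution N \<kappa> x y" "a / lam = ?e \<kappa> x y 0" "a = ?e \<kappa> x y 1"
      using weak_form_imp_cell_solution[OF \<kappa> deg(1) P] .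
    obtain x' y' where xy': "Q = cell_solution N (- \<kappa>) x' y'"
      "b / lam = ?e (- \<kappa>) x' y' 0" "b = ?e (- \<kappa>) x' y' 1"
      using weak_form_imp_cell_solution[OF _ deg(2) Q] \<kappa> by auto
    have "a / lam + b / lam = poly P 0 + poly Q 0"
      using ab lam by (simp flip: add_divide_distrib)
    then have x': "x' = - s * x"
      using coupling(1) xy xy' by simp
    have y': "y' = s * y"
      using coupling(2) xy xy' ab by simp
    have "?sys x y"
      using flux xy xy' x' y' by metis
    moreover have "(x, y) \<noteq> (0, 0)"
    proof
      assume "(x, y) = (0, 0)"
      then have "P = 0" "Q = 0"
        by (simp_all add: xy xy' x' y' cell_solution_def bubble_def exp_sum_def del: funpow.simps)
      with nz show False by simp
    qed
    ultimately show "\<exists>x y. (x, y) \<noteq> (0, 0) \<and> ?sys x y" by blast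
  next
    assume "\<exists>x y. (x, y) \<noteq> (0, 0) \<and> ?sys x y"
    then obtain x y where nz: "(x, y) \<noteq> (0, 0)" and sys: "?sys x y"
      by blast
    define a b where "a = ?e \<kappa> x y 1" "b = ?e (- \<kappa>) (- s * x) (s * y) 1"
    define P Q where "P = cell_solution N \<kappa> x y" "Q = cell_solution N (- \<kappa>) (- s * x) (s * y)"
    have e0: "?e \<kappa> x y 0 = a / lam" "?e (- \<kappa>) (- s * x) (s * y) 0 = b / lam"
      using flux sys by (simp_all add: a_b_def)
    have weak: "weak_form N \<kappa> P (a / lam) a" "weak_form N (- \<kappa>) Q (b / lam) b"
      using weak_form_cell_solution[of N \<kappa> x y] weak_form_cell_solution[of N "- \<kappa>" "- s * x" "s * y"]
      by (simp_all only: e0 P_Q_def a_b_def)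
    have "a / lam + b / lam = poly P 0 + poly Q 0"
      using coupling(1)[of x y "- s * x" "s * y"] e0 by (simp add: P_Q_def)
    then have ab0: "a + b = lam * (poly P 0 + poly Q 0)"
      using lam by (simp add: field_simps)
    have ab1: "a - b = poly P 1 - poly Q 1"
      using coupling(2)[of x y "- s * x" "s * y"] by (simp add: P_Q_def a_b_def)
    \<comment> \<open>If both polynomials were zero, both fluxes would be too; then the defects
      vanish, and with them \<open>x\<close> and \<open>y\<close>.\<close>
    have "P \<noteq> 0 \<or> Q \<noteq> 0"
    proof (rule ccontr)
      assume "\<not> (P \<noteq> 0 \<or> Q \<noteq> 0)"
      then have 0: "P = 0" "Q = 0" by auto
      then have "a = 0" using ab0 ab1 by simp
      then have "?e \<kappa> x y 0 = poly P 0" "?e \<kappa> x y 1 = poly P 1"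
        using 0 by (simp_all add: e0 flip: a_b_def)
      then have "\<kappa> ^ Suc N * fact N * x = 0" "\<kappa> ^ Suc N * (-1) ^ N * fact N * y = 0"
        unfolding exp_sum_bubble_eq P_Q_def by simp_all
      then show False using nz \<kappa> by simp
    qed
    then show "bloch_eigenvalue N \<kappa> lam"
      unfolding bloch_eigenvalue_def using weak ab0 ab1 degree_cell_solution_le
      by (intro exI[of _ P] exI[of _ Q] exI[of _ a] exI[of _ b]) (auto simp: P_Q_def)
  qed
  also have "\<dots> \<longleftrightarrow> (lam * p' - q) * (p' - lam * q) = (p - lam * q') * (q' - lam * p)"
    by (rule singular_2x2)
  also have "\<dots> \<longleftrightarrow> ?det"
    unfolding q_p_q'_p'_def[symmetric] by (simp add: power2_eq_square algebra_simps) argo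
  finally show ?thesis .
qed

text \<open>The defects of the two unknowns agree at the right end and cancel at the left end, while
  \<open>weak_form_0_defects\<close> relates the two ends by the same sign for both. So all defects
  vanish, \<open>P\<close> and \<open>Q\<close> are constant, and equal end values force the
  multiplier 1.\<close>

lemma bloch_eigenvalue_0:
  assumes lam: "lam \<noteq> 0"
  shows "bloch_eigenvalue N 0 lam \<longleftrightarrow> lam = 1"
proof
  assume "bloch_eigenvalue N 0 lam"
  then obtain P Q a b where deg: "degree P \<le> N" "degree Q \<le> N" and nz: "(P, Q) \<noteq> (0, 0)"
    and P: "weak_form N 0 P (a / lam) a" and Q: "weak_form N 0 Q (b / lam) b"
    and ab: "a + b = lam * (poly P 0 + poly Q 0)" "a - b = poly P 1 - poly Q 1"
    unfolding bloch_eigenvalue_def by auto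
  have sum: "a / lam + b / lam = poly P 0 + poly Q 0"
    using ab lam by (simp flip: add_divide_distrib)
  have dP: "(-1) ^ N * (a - poly P 1) = a / lam - poly P 0"
    and dQ: "(-1) ^ N * (b - poly Q 1) = b / lam - poly Q 0"
    using weak_form_0_defects[OF P deg(1)] weak_form_0_defects[OF Q deg(2)] by simp_all
  have eq: "b - poly Q 1 = a - poly P 1"
    using ab by (simp add: algebra_simps)
  have "(-1) ^ N * (a - poly P 1) + (-1) ^ N * (b - poly Q 1) = 0"
    unfolding dP dQ using sum by (simp add: algebra_simps)
  then have "a - poly P 1 = 0"
    unfolding eq by (simp flip: mult_2)
  with eq have "a - poly P 1 = 0" "b - poly Q 1 = 0"
    by simp_all
  with dP dQ
  have a: "a = poly P 1" "a / lam = poly P 0" and b: "b = poly Q 1" "b / lam = poly Q 0"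
    by simp_all
  have "pderiv P = 0" "pderiv Q = 0"
    using weak_form_homogeneous[OF deg(1), of 0] weak_form_homogeneous[OF deg(2), of 0] P Q a b by simp_all
  then obtain c d where c: "P = [:c:]" "Q = [:d:]"
    by (metis pderiv_iszero)
  with a b lam nz show "lam = 1"
    by (auto simp: field_simps)
next
  assume "lam = 1"
  moreover have "weak_form N 0 1 1 1" "weak_form N 0 0 0 0"
    by (simp_all add: weak_form_iff pderiv_1)
  ultimately show "bloch_eigenvalue N 0 lam"
    unfolding bloch_eigenvalue_def
    by (intro exI[of _ 1] exI[of _ 0]) simp
qed

subsection \<open>From the scheme to the unit interval\<close>

text \<open>With the unit interval as reference cell, i\<Omega> enters without the factor 1/2 that
  it has on [-1, 1].\<close>

definition to_unit :: "real \<Rightarrow> int \<Rightarrow> complex poly \<Rightarrow> complex poly" where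
  "to_unit h j p = pcompose p [:of_real (node h j), of_real h:]"

lemma node_add_1: "node h (j + 1) = node h j + h"
  by (simp add: node_def algebra_simps)

lemma poly_to_unit: "poly (to_unit h j p) x = poly p (of_real (node h j) + x * of_real h)"
  by (simp add: to_unit_def poly_pcompose)

lemma poly_to_unit_endpoints:
  "poly (to_unit h j p) 0 = poly p (of_real (node h j))"
  "poly (to_unit h j p) 1 = poly p (of_real (node h (j + 1)))"
  by (simp_all add: poly_to_unit node_add_1)

lemma to_unit_mult: "to_unit h j (p * q) = to_unit h j p * to_unit h j q"
  by (simp add: to_unit_def pcompose_mult)

lemma to_unit_smult: "to_unit h j (smult c p) = smult c (to_unit h j p)"
  by (simp add: to_unit_def pcompose_smult)

lemma pderiv_to_unit: "pderiv (to_unit h j p) = smult (of_real h) (to_unit h j (pderiv p))"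
  by (simp add: to_unit_def pderiv_pcompose pderiv_pCons)

lemma degree_to_unit: "h \<noteq> 0 \<Longrightarrow> degree (to_unit h j p) = degree p"
  by (simp add: to_unit_def degree_pcompose)

lemma to_unit_surj:
  assumes "h \<noteq> 0"
  obtains p where "to_unit h j p = P" "degree p = degree P"
proof -
  define p where "p = pcompose P [:- of_real (node h j / h), of_real (1 / h):]"
  have "to_unit h j p = P"
    using assms by (intro poly_eq_poly_eq_iff[THEN iffD1] ext) (simp add: poly_to_unit p_def poly_pcompose field_simps)
  then show thesis
    using that degree_to_unit[OF assms] by metis
qed

lemma to_unit_eq_0_iff: "h \<noteq> 0 \<Longrightarrow> to_unit h j p = 0 \<longleftrightarrow> p = 0"
  by (auto simp: to_unit_def pcompose_eq_0_iff)

section \<open>Traces, integrals and derivatives on a cell\<close>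

lemma tendsto_poly_of_real: "((\<lambda>t. poly (p :: complex poly) (of_real t)) \<longlongrightarrow> poly p (of_real x)) (at x within S)"
  by (intro tendsto_intros)

lemma trace_left_poly:
  assumes "h > 0" "\<forall>x\<in>cell h j. f x = poly p (of_real x)"
  shows "trace_left f (node h (j + 1)) = poly (to_unit h j p) 1"
  unfolding trace_left_def poly_to_unit_endpoints
proof (rule tendsto_Lim)
  have "eventually (\<lambda>x. f x = poly p (of_real x)) (at_left (node h (j + 1)))"
    unfolding eventually_at_left_field
    by (rule exI[of _ "node h j"]) (use assms in \<open>auto simp: cell_def node_add_1\<close>)
  then show "(f \<longlongrightarrow> poly p (of_real (node h (j + 1)))) (at_left (node h (j + 1)))"
    using tendsto_poly_of_real by (simp add: tendsto_cong)
qed simp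

lemma trace_right_poly:
  assumes "h > 0" "\<forall>x\<in>cell h j. f x = poly p (of_real x)"
  shows "trace_right f (node h j) = poly (to_unit h j p) 0"
  unfolding trace_right_def poly_to_unit_endpoints
proof (rule tendsto_Lim)
  have "eventually (\<lambda>x. f x = poly p (of_real x)) (at_right (node h j))"
    unfolding eventually_at_right_field
    by (rule exI[of _ "node h (j + 1)"]) (use assms in \<open>auto simp: cell_def node_add_1\<close>)
  then show "(f \<longlongrightarrow> poly p (of_real (node h j))) (at_right (node h j))"
    using tendsto_poly_of_real by (simp add: tendsto_cong)
qed simp

text \<open>Affine substitution; passing from the open cell to its closure does not change the
  integral.\<close>

lemma integral_cell_poly:
  assumes h: "h > 0" and f: "\<forall>x\<in>cell h j. f x = poly p (of_real x)"
  shows "integral (cell h j) f = of_real h * unit_integral (to_unit h j p)"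
proof -
  let ?g = "\<lambda>t. poly p (of_real t)" and ?a = "node h j" and ?b = "node h (j + 1)"
  have "(?g has_integral integral {?a..?b} ?g) (cbox ?a ?b)"
    using integrable_integral[OF integrable_poly_of_real] by simp
  from has_integral_affinity'[OF this h, of ?a]
  have "((\<lambda>t. poly (to_unit h j p) (of_real t)) has_integral integral {?a..?b} ?g /\<^sub>R h) {0..1}"
    using h by (simp add: node_add_1 poly_to_unit mult.commute[of h]) (simp add: add.commute)
  then have "unit_integral (to_unit h j p) = integral {?a..?b} ?g /\<^sub>R h"
    unfolding unit_integral_def by (rule integral_unique)
  moreover have "integral (cell h j) f = integral (cell h j) ?g"
    using f by (intro integral_cong) simp
  ultimately show ?thesis
    using h by (simp add: cell_def integral_open_interval_real scaleR_conv_of_real)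
qed

lemma vector_derivative_cell_poly:
  fixes f :: "real \<Rightarrow> complex"
  assumes f: "\<forall>x\<in>cell h j. f x = poly p (of_real x)" and x: "x \<in> cell h j"
  shows "vector_derivative f (at x) = poly (pderiv p) (of_real x)"
proof (rule vector_derivative_at)
  show "(f has_vector_derivative poly (pderiv p) (of_real x)) (at x)"
    by (rule has_vector_derivative_transform_within_open[OF has_vector_derivative_poly_of_real _ x])
      (use f in \<open>auto simp: cell_def\<close>)
qed

section \<open>Bloch waves on a single cell\<close>

definition cell_fun :: "real \<Rightarrow> complex poly \<Rightarrow> real \<Rightarrow> complex" where
  "cell_fun h p = (\<lambda>x. if x \<in> cell h 0 then poly p (of_real x) else 0)"

lemma cell_polys_eq: "cell_polys h N = {cell_fun h p |p. degree p \<le> N}"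
  by (auto simp: cell_polys_def cell_fun_def)

lemma cell_fun_eq_0_iff:
  assumes "h > 0"
  shows "cell_fun h p = (\<lambda>_. 0) \<longleftrightarrow> p = 0"
proof
  assume *: "cell_fun h p = (\<lambda>_. 0)"
  show "p = 0"
  proof (rule poly_eq_0_of_real_interval[of "node h 0" "node h (0 + 1)"])
    show "poly p (of_real t) = 0" if "node h 0 < t" "t < node h (0 + 1)" for t
      using fun_cong[OF *, of t] that by (simp add: cell_fun_def cell_def)
  qed (use assms in \<open>simp only: node_add_1 less_add_same_cancel1\<close>)
qed (auto simp: cell_fun_def)

lemma shift_in_cell_iff: "x - of_int m * h \<in> cell h 0 \<longleftrightarrow> x \<in> cell h m"
  by (auto simp: cell_def node_def algebra_simps)

lemma cell_disjoint:
  assumes "h > 0" "x \<in> cell h j" "x \<in> cell h m"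
  shows "j = m"
proof -
  have "(of_int j - 1 / 2) * h < (of_int m + 1 / 2) * h" "(of_int m - 1 / 2) * h < (of_int j + 1 / 2) * h"
    using assms(2,3) by (simp_all add: cell_def node_def algebra_simps)
  then have "real_of_int j - 1 / 2 < of_int m + 1 / 2" "real_of_int m - 1 / 2 < of_int j + 1 / 2"
    using \<open>h > 0\<close> by (simp_all only: mult_less_cancel_right_pos)
  then show ?thesis by linarith
qed

text \<open>The cells are disjoint, so only the summand with m = j survives.\<close>

lemma bloch_wave_cell_fun:
  assumes "h > 0" "x \<in> cell h j"
  shows "bloch_wave h \<omega> lam (cell_fun h p) x t =
    exp (- \<i> * of_real (\<omega> * t)) * (lam powi j * poly p (of_real (x - of_int j * h)))"
proof -
  have "(\<Sum>\<^sub>\<infinity>m::int. lam powi m * cell_fun h p (x - of_int m * h)) =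
      (\<Sum>\<^sub>\<infinity>m\<in>{j}. lam powi m * cell_fun h p (x - of_int m * h))"
    by (rule infsum_cong_neutral)
      (use cell_disjoint[OF assms] in \<open>auto simp: cell_fun_def shift_in_cell_iff\<close>)
  also have "\<dots> = lam powi j * poly p (of_real (x - of_int j * h))"
    using assms(2) by (simp add: cell_fun_def shift_in_cell_iff)
  finally show ?thesis
    by (simp add: bloch_wave_def)
qed

definition wave_poly :: "real \<Rightarrow> real \<Rightarrow> complex \<Rightarrow> complex poly \<Rightarrow> real \<Rightarrow> int \<Rightarrow> complex poly" where
  "wave_poly h \<omega> lam p t j =
     smult (exp (- \<i> * of_real (\<omega> * t)) * lam powi j) (pcompose p [:- of_real (of_int j * h), 1:])"

lemma bloch_wave_eq_wave_poly:
  assumes "h > 0" "x \<in> cell h j"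
  shows "bloch_wave h \<omega> lam (cell_fun h p) x t = poly (wave_poly h \<omega> lam p t j) (of_real x)"
  using bloch_wave_cell_fun[OF assms] by (simp add: wave_poly_def poly_pcompose)

lemma bloch_wave_on_cell:
  "h > 0 \<Longrightarrow> \<forall>x\<in>cell h j. bloch_wave h \<omega> lam (cell_fun h p) x t = poly (wave_poly h \<omega> lam p t j) (of_real x)"
  by (simp add: bloch_wave_eq_wave_poly)

text \<open>The shift by j cells cancels against the position of the node. In reference coordinates
  all cells and times thus differ by a scalar only, which reduces the scheme to one cell.\<close>

lemma to_unit_wave_poly:
  "to_unit h j (wave_poly h \<omega> lam p t j) =
     smult (exp (- \<i> * of_real (\<omega> * t)) * lam powi j) (to_unit h 0 p)"
  by (intro poly_eq_poly_eq_iff[THEN iffD1] ext)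
    (simp add: poly_to_unit wave_poly_def poly_pcompose node_def algebra_simps)

lemma bloch_wave_has_vector_derivative:
  "(bloch_wave h \<omega> lam U x has_vector_derivative - \<i> * of_real \<omega> * bloch_wave h \<omega> lam U x t) (at t)"
  unfolding bloch_wave_def
  by (rule has_vector_derivative_real_field derivative_eq_intros refl | simp)+

lemma bloch_wave_in_dg_space:
  assumes "h > 0" "degree p \<le> N"
  shows "(\<lambda>x. bloch_wave h \<omega> lam (cell_fun h p) x t) \<in> dg_space h N"
proof -
  have "degree (wave_poly h \<omega> lam p t j) \<le> N" for j
    using assms(2) by (simp add: wave_poly_def degree_pcompose)
  then show ?thesis
    using bloch_wave_eq_wave_poly[OF assms(1)] unfolding dg_space_def by blast
qed

text \<open>For \<alpha> = 1 the flux is upwind in characteristic variables: half the right trace of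
  u + \<phi> plus half the left trace of u - \<phi>. The left trace comes from cell j - 1, hence the
  division by \<open>lam\<close>.\<close>

lemma num_flux_bloch_wave:
  fixes h \<omega> lam p q t
  assumes h: "h > 0" and lam: "lam \<noteq> 0"
  defines "u \<equiv> \<lambda>x. bloch_wave h \<omega> lam (cell_fun h p) x t"
    and "\<phi> \<equiv> \<lambda>x. bloch_wave h \<omega> lam (cell_fun h q) x t"
    and "P \<equiv> to_unit h 0 p" and "Q \<equiv> to_unit h 0 q"
  shows "num_flux 1 u \<phi> (node h j) = exp (- \<i> * of_real (\<omega> * t)) * lam powi j *
    ((lam * (poly P 0 + poly Q 0) + (poly P 1 - poly Q 1)) / 2 / lam)"
proof -
  let ?c = "\<lambda>j. exp (- \<i> * of_real (\<omega> * t)) * lam powi j"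
  have right: "trace_right (\<lambda>x. bloch_wave h \<omega> lam (cell_fun h r) x t) (node h j) =
      ?c j * poly (to_unit h 0 r) 0" for r
    by (simp add: trace_right_poly[OF h bloch_wave_on_cell[OF h]] to_unit_wave_poly)
  have left: "trace_left (\<lambda>x. bloch_wave h \<omega> lam (cell_fun h r) x t) (node h j) =
      ?c (j - 1) * poly (to_unit h 0 r) 1" for r
    using trace_left_poly[OF h bloch_wave_on_cell[OF h, of "j - 1" \<omega> lam r t]]
    by (simp add: to_unit_wave_poly)
  have pred: "lam powi (j - 1) = lam powi j / lam"
    using lam by (simp add: power_int_diff)
  show ?thesis
    unfolding num_flux_def mean_def jump_def u_def \<phi>_def P_def Q_def right left pred
    using lam by (simp add: field_simps)
qed

text \<open>\<open>a\<close> and \<open>b\<close> are the fluxes at the right end of the cell, up to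
  the exponential and the power of \<open>lam\<close>. That common factor is nonzero and cancels, so
  all cells and times give the same condition.\<close>

lemma dg_solution_bloch_wave_iff:
  fixes h \<omega> lam p q
  assumes h: "h > 0" and lam: "lam \<noteq> 0" and p: "degree p \<le> N" and q: "degree q \<le> N"
  defines "P \<equiv> to_unit h 0 p" and "Q \<equiv> to_unit h 0 q"
  defines "a \<equiv> (lam * (poly P 0 + poly Q 0) + (poly P 1 - poly Q 1)) / 2"
    and "b \<equiv> (lam * (poly Q 0 + poly P 0) + (poly Q 1 - poly P 1)) / 2"
  shows "dg_solution 1 h N (bloch_wave h \<omega> lam (cell_fun h p)) (bloch_wave h \<omega> lam (cell_fun h q)) \<longleftrightarrow>
    weak_form N (\<i> * of_real (\<omega> * h)) P (a / lam) a \<and>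
    weak_form N (- (\<i> * of_real (\<omega> * h))) Q (b / lam) b" (is "dg_solution 1 h N ?u ?\<phi> \<longleftrightarrow> ?weak")
proof -
  let ?c = "\<lambda>t j. exp (- \<i> * of_real (\<omega> * t)) * lam powi j"
  let ?\<kappa> = "\<i> * complex_of_real (\<omega> * h)"
  have c: "?c t j \<noteq> 0" for t j
    using lam by simp
  \<comment> \<open>The time derivative contributes -i\<omega> and the substitution contributes h;
    together they give -\<kappa>.\<close>
  have int_t: "integral (cell h j) (\<lambda>x. vector_derivative (bloch_wave h \<omega> lam (cell_fun h r) x) (at t) * v x) =
      - ?\<kappa> * ?c t j * unit_integral (to_unit h 0 r * to_unit h j w)"
    if v: "\<forall>x\<in>cell h j. v x = poly w (of_real x)" for r t j v w
  proof -
    let ?w = "smult (- \<i> * of_real \<omega>) (wave_poly h \<omega> lam r t j * w)"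
    have "integral (cell h j) (\<lambda>x. vector_derivative (bloch_wave h \<omega> lam (cell_fun h r) x) (at t) * v x) =
        of_real h * unit_integral (to_unit h j ?w)"
      by (rule integral_cell_poly[OF h])
        (simp add: v vector_derivative_at[OF bloch_wave_has_vector_derivative] bloch_wave_eq_wave_poly[OF h])
    moreover have "to_unit h j ?w = smult (- \<i> * of_real \<omega> * ?c t j) (to_unit h 0 r * to_unit h j w)"
      unfolding to_unit_smult to_unit_mult to_unit_wave_poly by simp
    ultimately show ?thesis
      by (simp add: unit_integral_smult del: smult_minus_left)
  qed
  \<comment> \<open>Here the h of the substitution is absorbed by the chain rule.\<close>
  have int_x: "integral (cell h j) (\<lambda>x. bloch_wave h \<omega> lam (cell_fun h r) x t * vector_derivative v (at x)) =
      ?c t j * unit_integral (to_unit h 0 r * pderiv (to_unit h j w))"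
    if v: "\<forall>x\<in>cell h j. v x = poly w (of_real x)" for r t j v w
  proof -
    let ?w = "wave_poly h \<omega> lam r t j * pderiv w"
    have "integral (cell h j) (\<lambda>x. bloch_wave h \<omega> lam (cell_fun h r) x t * vector_derivative v (at x)) =
        of_real h * unit_integral (to_unit h j ?w)"
      by (rule integral_cell_poly[OF h])
        (simp add: vector_derivative_cell_poly[OF v] bloch_wave_eq_wave_poly[OF h])
    then show ?thesis
      by (simp add: to_unit_mult to_unit_wave_poly pderiv_to_unit unit_integral_smult)
  qed
  have powi_Suc: "lam powi (j + 1) = lam * lam powi j" for j
    using lam by (simp add: power_int_add)
  have scheme_u: "integral (cell h j) (\<lambda>x. vector_derivative (?u x) (at t) * v x)
        - integral (cell h j) (\<lambda>x. ?u x t * vector_derivative v (at x))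
        + num_flux 1 (\<lambda>x. ?u x t) (\<lambda>x. ?\<phi> x t) (node h (j + 1)) * trace_left v (node h (j + 1))
        - num_flux 1 (\<lambda>x. ?u x t) (\<lambda>x. ?\<phi> x t) (node h j) * trace_right v (node h j) = 0 \<longleftrightarrow>
      unit_integral (P * pderiv V) + ?\<kappa> * unit_integral (P * V) = a * poly V 1 - a / lam * poly V 0"
    (is "?lhs = 0 \<longleftrightarrow> ?rhs")
    if v: "\<forall>x\<in>cell h j. v x = poly w (of_real x)" and V: "V = to_unit h j w" for t j v w V
  proof -
    have "?lhs = ?c t j * (a * poly V 1 - a / lam * poly V 0 -
        (unit_integral (P * pderiv V) + ?\<kappa> * unit_integral (P * V)))"
      unfolding int_t[OF v] int_x[OF v] num_flux_bloch_wave[OF h lam] powi_Suc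
        trace_left_poly[OF h v] trace_right_poly[OF h v]
        V[symmetric] P_def[symmetric] Q_def[symmetric] a_def[symmetric]
      using lam by (simp add: algebra_simps)
    then show ?thesis
      using c[of t j] by auto
  qed
  have scheme_\<phi>: "integral (cell h j) (\<lambda>x. vector_derivative (?\<phi> x) (at t) * v x)
        + integral (cell h j) (\<lambda>x. ?\<phi> x t * vector_derivative v (at x))
        - num_flux 1 (\<lambda>x. ?\<phi> x t) (\<lambda>x. ?u x t) (node h (j + 1)) * trace_left v (node h (j + 1))
        + num_flux 1 (\<lambda>x. ?\<phi> x t) (\<lambda>x. ?u x t) (node h j) * trace_right v (node h j) = 0 \<longleftrightarrow>
      unit_integral (Q * pderiv V) + - ?\<kappa> * unit_integral (Q * V) = b * poly V 1 - b / lam * poly V 0"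
    (is "?lhs = 0 \<longleftrightarrow> ?rhs")
    if v: "\<forall>x\<in>cell h j. v x = poly w (of_real x)" and V: "V = to_unit h j w" for t j v w V
  proof -
    have "?lhs = ?c t j * (unit_integral (Q * pderiv V) + - ?\<kappa> * unit_integral (Q * V) -
        (b * poly V 1 - b / lam * poly V 0))"
      unfolding int_t[OF v] int_x[OF v] num_flux_bloch_wave[OF h lam] powi_Suc
        trace_left_poly[OF h v] trace_right_poly[OF h v]
        V[symmetric] P_def[symmetric] Q_def[symmetric] b_def[symmetric]
      using lam by (simp add: algebra_simps)
    then show ?thesis
      using c[of t j] by auto
  qed
  show ?thesis
  proof
    assume sol: "dg_solution 1 h N ?u ?\<phi>"
    have test: "(unit_integral (P * pderiv V) + ?\<kappa> * unit_integral (P * V) = a * poly V 1 - a / lam * poly V 0)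
        \<and> (unit_integral (Q * pderiv V) + - ?\<kappa> * unit_integral (Q * V) = b * poly V 1 - b / lam * poly V 0)"
      if "degree V \<le> N" for V
    proof -
      obtain w where w: "to_unit h 0 w = V" "degree w = degree V"
        using to_unit_surj[of h 0 V] h by auto
      \<comment> \<open>One global polynomial serves as test function; cell 0 at time 0 already
        yields the weak form.\<close>
      let ?v = "\<lambda>x. poly w (complex_of_real x)"
      have v: "?v \<in> dg_space h N"
        using w that unfolding dg_space_def by (auto intro!: exI[of _ w])
      have ball: "\<forall>x\<in>cell h 0. ?v x = poly w (of_real x)"
        by simp
      note eqs = sol[unfolded dg_solution_def, THEN conjunct2, THEN conjunct2, rule_format, OF v v]
      show ?thesis
        using scheme_u[OF ball w(1)[symmetric], of 0] scheme_\<phi>[OF ball w(1)[symmetric], of 0]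
          eqs[of 0 0]
        by (simp only: simp_thms)
    qed
    then show ?weak
      unfolding weak_form_def by blast
  next
    assume weak: ?weak
    show "dg_solution 1 h N ?u ?\<phi>"
      unfolding dg_solution_def
    proof (intro conjI allI ballI)
      fix t j v \<psi>
      assume "v \<in> dg_space h N" "\<psi> \<in> dg_space h N"
      then obtain w z where w: "degree w \<le> N" "\<forall>x\<in>cell h j. v x = poly w (of_real x)"
        and z: "degree z \<le> N" "\<forall>x\<in>cell h j. \<psi> x = poly z (of_real x)"
        unfolding dg_space_def by blast
      have deg: "degree (to_unit h j w) \<le> N" "degree (to_unit h j z) \<le> N"
        using w z h by (simp_all add: degree_to_unit)
      show "integral (cell h j) (\<lambda>x. vector_derivative (?u x) (at t) * v x)
        - integral (cell h j) (\<lambda>x. ?u x t * vector_derivative v (at x))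
        + num_flux 1 (\<lambda>x. ?u x t) (\<lambda>x. ?\<phi> x t) (node h (j + 1)) * trace_left v (node h (j + 1))
        - num_flux 1 (\<lambda>x. ?u x t) (\<lambda>x. ?\<phi> x t) (node h j) * trace_right v (node h j) = 0"
        by (rule scheme_u[OF w(2) refl, THEN iffD2]) (use weak deg in \<open>auto simp: weak_form_def\<close>)
      show "integral (cell h j) (\<lambda>x. vector_derivative (?\<phi> x) (at t) * \<psi> x)
        + integral (cell h j) (\<lambda>x. ?\<phi> x t * vector_derivative \<psi> (at x))
        - num_flux 1 (\<lambda>x. ?\<phi> x t) (\<lambda>x. ?u x t) (node h (j + 1)) * trace_left \<psi> (node h (j + 1))
        + num_flux 1 (\<lambda>x. ?\<phi> x t) (\<lambda>x. ?u x t) (node h j) * trace_right \<psi> (node h j) = 0"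
        by (rule scheme_\<phi>[OF z(2) refl, THEN iffD2]) (use weak deg in \<open>auto simp: weak_form_def\<close>)
    qed (use bloch_wave_in_dg_space[OF h] p q bloch_wave_has_vector_derivative differentiableI_vector
         in \<open>blast+\<close>)
  qed
qed

text \<open>The two flux equations in \<open>bloch_eigenvalue\<close> determine \<open>a\<close> and
  \<open>b\<close> uniquely; half their sum and half their difference are the explicit fluxes of
  \<open>dg_solution_bloch_wave_iff\<close>.\<close>

lemma bloch_wave_exists_iff:
  assumes h: "h > 0" and lam: "lam \<noteq> 0"
  shows "(\<exists>U \<Phi>. U \<in> cell_polys h N \<and> \<Phi> \<in> cell_polys h N \<and> (U, \<Phi>) \<noteq> ((\<lambda>_. 0), (\<lambda>_. 0)) \<and>
      dg_solution 1 h N (bloch_wave h \<omega> lam U) (bloch_wave h \<omega> lam \<Phi>)) \<longleftrightarrow>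
    bloch_eigenvalue N (\<i> * of_real (\<omega> * h)) lam" (is "?lhs \<longleftrightarrow> _")
proof
  assume ?lhs
  then obtain p q where pq: "degree p \<le> N" "degree q \<le> N"
    and nz: "(cell_fun h p, cell_fun h q) \<noteq> ((\<lambda>_. 0), (\<lambda>_. 0))"
    and sol: "dg_solution 1 h N (bloch_wave h \<omega> lam (cell_fun h p)) (bloch_wave h \<omega> lam (cell_fun h q))"
    unfolding cell_polys_eq by blast
  let ?P = "to_unit h 0 p" and ?Q = "to_unit h 0 q"
  let ?a = "(lam * (poly ?P 0 + poly ?Q 0) + (poly ?P 1 - poly ?Q 1)) / 2"
  let ?b = "(lam * (poly ?Q 0 + poly ?P 0) + (poly ?Q 1 - poly ?P 1)) / 2"
  have "(?P, ?Q) \<noteq> (0, 0)"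
    using nz h by (auto simp: cell_fun_eq_0_iff to_unit_eq_0_iff)
  moreover have "?a + ?b = lam * (poly ?P 0 + poly ?Q 0)" "?a - ?b = poly ?P 1 - poly ?Q 1"
    by (simp_all add: field_simps)
  moreover have "degree ?P \<le> N" "degree ?Q \<le> N"
    using pq h by (simp_all add: degree_to_unit)
  ultimately show "bloch_eigenvalue N (\<i> * of_real (\<omega> * h)) lam"
    using sol[unfolded dg_solution_bloch_wave_iff[OF h lam pq]]
    unfolding bloch_eigenvalue_def by blast
next
  assume "bloch_eigenvalue N (\<i> * of_real (\<omega> * h)) lam"
  then obtain P Q a b where deg: "degree P \<le> N" "degree Q \<le> N" and nz: "(P, Q) \<noteq> (0, 0)"
    and weak: "weak_form N (\<i> * of_real (\<omega> * h)) P (a / lam) a"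
      "weak_form N (- (\<i> * of_real (\<omega> * h))) Q (b / lam) b"
    and sum: "a + b = lam * (poly P 0 + poly Q 0)" and diff: "a - b = poly P 1 - poly Q 1"
    unfolding bloch_eigenvalue_def by blast
  obtain p where p: "to_unit h 0 p = P" "degree p = degree P"
    using to_unit_surj[of h 0 P] h by auto
  obtain q where q: "to_unit h 0 q = Q" "degree q = degree Q"
    using to_unit_surj[of h 0 Q] h by auto
  have "(lam * (poly P 0 + poly Q 0) + (poly P 1 - poly Q 1)) / 2 = a"
    unfolding sum[symmetric] diff[symmetric] by simp
  moreover have "(lam * (poly Q 0 + poly P 0) + (poly Q 1 - poly P 1)) / 2 = b"
    using sum diff by (simp add: field_simps) algebra
  ultimately have "dg_solution 1 h N (bloch_wave h \<omega> lam (cell_fun h p)) (bloch_wave h \<omega> lam (cell_fun h q))"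
    using dg_solution_bloch_wave_iff[OF h lam, of p N q] deg weak p q by simp
  moreover have "(cell_fun h p, cell_fun h q) \<noteq> ((\<lambda>_. 0), (\<lambda>_. 0))"
    using nz h p q by (auto simp: cell_fun_eq_0_iff to_unit_def)
  ultimately show ?lhs
    using p q deg unfolding cell_polys_eq by (intro exI[of _ "cell_fun h p"] exI[of _ "cell_fun h q"]) auto
qed

section \<open>The quadratic equation for the multiplier\<close>

lemma F_at_0: "F_N N 0 = 1" "F_N1 N 0 = 1"
proof -
  have "hyp_1F1 a b 0 = 1" for a b
  proof -
    have "hyp_1F1 a b 0 = (\<Sum>m\<in>{0}. pochhammer a m / pochhammer b m * (0 ^ m / fact m))"
      unfolding hyp_1F1_def by (rule suminf_finite) (auto simp: power_0_left)
    then show ?thesis by simp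
  qed
  then show "F_N N 0 = 1" "F_N1 N 0 = 1"
    by (simp_all add: F_N_def F_N1_def)
qed

lemma lambda_roots: "{z. z\<^sup>2 - Xi N \<Omega> * z + 1 = 0} = {lambda_plus N \<Omega>, lambda_minus N \<Omega>}"
proof -
  define r where "r = csqrt ((Xi N \<Omega>)\<^sup>2 - 4)"
  have r: "r * r = Xi N \<Omega> * Xi N \<Omega> - 4"
    using power2_csqrt[of "(Xi N \<Omega>)\<^sup>2 - 4"] by (simp add: r_def power2_eq_square)
  have "z\<^sup>2 - Xi N \<Omega> * z + 1 = (z - lambda_plus N \<Omega>) * (z - lambda_minus N \<Omega>)" for z
    using r by (simp add: lambda_plus_def lambda_minus_def flip: r_def)
      (simp add: field_simps power2_eq_square)
  then show ?thesis
    by auto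
qed

text \<open>For \<Omega> = 0 the numerator is 4 and the denominator 2, so the quadratic has the
  double root 1, in agreement with \<open>bloch_eigenvalue_0\<close>. Otherwise divide the
  determinant condition by the denominator.\<close>

lemma bloch_eigenvalue_iff:
  assumes den: "Xi_den N \<Omega> \<noteq> 0" and lam: "lam \<noteq> 0"
  shows "bloch_eigenvalue N (\<i> * of_real \<Omega>) lam \<longleftrightarrow> lam\<^sup>2 - Xi N \<Omega> * lam + 1 = 0"
proof -
  have "bloch_eigenvalue N (\<i> * of_real \<Omega>) lam \<longleftrightarrow>
      (1 + lam\<^sup>2) * Xi_den N \<Omega> = lam * Xi_num N \<Omega>"
  proof (cases "\<Omega> = 0")
    case True
    have "(1 + lam\<^sup>2) * 2 - lam * 4 = 2 * (lam - 1)\<^sup>2"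
      by (simp add: power2_eq_square algebra_simps)
    then have "(1 + lam\<^sup>2) * 2 = lam * 4 \<longleftrightarrow> lam = 1"
      by (simp only: eq_iff_diff_eq_0[of "(1 + lam\<^sup>2) * 2"]) simp
    then show ?thesis
      using True lam by (simp add: bloch_eigenvalue_0 Xi_den_def Xi_num_def F_at_0)
  next
    case False
    then show ?thesis
      using bloch_eigenvalue_nonzero[of "\<i> * of_real \<Omega>" lam N] lam
      by (simp add: Xi_den_def Xi_num_def)
  qed
  also have "\<dots> \<longleftrightarrow> lam\<^sup>2 - Xi N \<Omega> * lam + 1 = 0"
    unfolding Xi_def using den by (simp add: field_simps)
  finally show ?thesis .
qed

theorem theorem4p1:
  fixes N :: nat and h \<omega> \<Omega> :: real and lam :: complex
  assumes "h > 0"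
    and "\<Omega> = \<omega> * h"
    and "Xi_den N \<Omega> \<noteq> 0"
    and "lam \<noteq> 0"
  shows "((\<exists>U \<Phi>. U \<in> cell_polys h N \<and> \<Phi> \<in> cell_polys h N \<and>
             (U, \<Phi>) \<noteq> ((\<lambda>_. 0), (\<lambda>_. 0)) \<and>
             dg_solution 1 h N (bloch_wave h \<omega> lam U) (bloch_wave h \<omega> lam \<Phi>))
          \<longleftrightarrow> lam \<in> {lambda_plus N \<Omega>, lambda_minus N \<Omega>})
         \<and> {z :: complex. z\<^sup>2 - Xi N \<Omega> * z + 1 = 0} = {lambda_plus N \<Omega>, lambda_minus N \<Omega>}"
  unfolding bloch_wave_exists_iff[OF assms(1,4)] lambda_roots[symmetric]
  using bloch_eigenvalue_iff[OF assms(3,4)] assms(2) by simp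

end
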